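(* Assume that $\alpha_n/\log n$ remains bounded away from $0$ and $\infty$. Then $$\left(1-\frac{\alpha_n}{\zeta_n}\right)(M_n - \zeta_n) + \log \left(1-\frac{\alpha_n}{\zeta_n}\right)$$ converges in distribution to $G$ as $n\to\infty$, where $\zeta_n / \alpha_n$ is (for all sufficiently large $n$) the unique solution bigger than $1$ of the equation (in the unknown $z$) $$z = 1 + \frac{\log n}{\alpha_n} - \frac{\log \sqrt{2 \pi} + \frac12 \log \alpha_n}{\alpha_n} + \left(1 - \frac1{\alpha_n}\right) \log z.$$
   Context: Let $(\alpha_n)_{n\ge 1}$ be a sequence of positive real numbers. For each $n$, let $Y_{1n},\ldots,Y_{nn}$ be i.i.d. random variables with the Gamma$(\alpha_n,1)$ distribution, i.e. with density $u^{\alpha_n-1}e^{-u}/\Gamma(\alpha_n)$ on $(0,\infty)$, and let $M_n=\max\{Y_{1n},\ldots,Y_{nn}\}$. $G$ denotes the Gumbel distribution, with distribution function $G(x)=\exp(-e^{-x})$, $x\in\mathbb R$. *)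

theory Defs
  imports "HOL-Probability.Probability" "HOL-Real_Asymp.Real_Asymp"
begin

definition gamma_density :: "real \<Rightarrow> real \<Rightarrow> real" where
  "gamma_density a u = (if u > 0 then u powr (a - 1) * exp (- u) / Gamma a else 0)"

definition gumbel_cdf :: "real \<Rightarrow> real" where
  "gumbel_cdf x = exp (- exp (- x))"

definition gumbel :: "real measure" where
  "gumbel = interval_measure gumbel_cdf"

lemma
  shows real_distribution_gumbel: "real_distribution gumbel"
    and cdf_gumbel: "cdf gumbel = gumbel_cdf"
proof -
  have mono: "gumbel_cdf x \<le> gumbel_cdf y" if "x \<le> y" for x y
    using that by (simp add: gumbel_cdf_def)
  have cont: "continuous (at_right x) gumbel_cdf" for x
    unfolding gumbel_cdf_def by (intro continuous_intros)
  have bot: "(gumbel_cdf \<longlongrightarrow> 0) at_bot" and top: "(gumbel_cdf \<longlongrightarrow> 1) at_top"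
    unfolding gumbel_cdf_def by real_asymp+
  show "real_distribution gumbel"
    unfolding gumbel_def by (rule real_distribution_interval_measure[OF mono cont bot top])
  show "cdf gumbel = gumbel_cdf"
    unfolding gumbel_def by (rule cdf_interval_measure[OF mono cont bot])
qed

text \<open>The equation in the unknown \<open>z\<close> whose solution bigger than 1 is \<open>\<zeta>\<^sub>n / \<alpha>\<^sub>n\<close>;
  here \<open>a\<close> stands for \<open>\<alpha>\<^sub>n\<close>.\<close>

definition centering_eq :: "nat \<Rightarrow> real \<Rightarrow> real \<Rightarrow> bool" where
  "centering_eq n a z \<longleftrightarrow>
     z = 1 + ln (real n) / a - (ln (sqrt (2 * pi)) + 1 / 2 * ln a) / a + (1 - 1 / a) * ln z"

end

theory Submission
  imports Defs
begin

text \<open>Write \<open>f\<close> for the Gamma density, \<open>a = \<alpha> n\<close>, \<open>\<zeta> = \<zeta> n\<close> and \<open>\<kappa> = 1 - a / \<zeta>\<close>. Stirling's formula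
  shows that the equation for \<open>\<zeta> / a\<close> says exactly that \<open>n * f \<zeta> \<longlonglongrightarrow> 1\<close>. Because \<open>\<alpha> n\<close> is of
  order \<open>ln n\<close>, it tends to infinity while \<open>\<kappa>\<close> stays away from 0. Hence near \<open>\<zeta>\<close> the density decays
  like \<open>f (\<zeta> + v) \<approx> f \<zeta> * exp (- \<kappa> * v)\<close>, and by dominated convergence the expected number of
  observations beyond \<open>\<zeta> + (x - ln \<kappa>) / \<kappa>\<close> tends to \<open>exp (- x)\<close>. By independence the
  probability that there is none tends to \<open>exp (- exp (- x))\<close>. Stirling's formula for real
  arguments itself follows from Laplace's method applied to Euler's integral.\<close>

section \<open>Elementary integrals, logarithm bounds and the Poisson-type limit\<close>

text \<open>Supplies the exponential majorants for both dominated convergence arguments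
  (\<open>l = 1/2\<close> and \<open>l = 1\<close>) and, for \<open>l = 1\<close>, the limiting tail
  mass \<open>exp (- x)\<close>.\<close>

lemma has_bochner_integral_exp_tail:
  fixes l x :: real
  assumes "l > 0"
  shows "has_bochner_integral lborel (\<lambda>s. indicator {x..} s * exp (- (l * s))) (exp (- (l * x)) / l)"
proof (rule has_bochner_integral_nn_integral)
  have "(\<integral>\<^sup>+s. ennreal (exp (- (l * s))) * indicator {x..} s \<partial>lborel)
      = ennreal (0 - (- exp (- (l * x)) / l))"
  proof (rule nn_integral_FTC_atLeast)
    show "((\<lambda>s. - exp (- (l * s)) / l) \<longlongrightarrow> 0) at_top"
      using assms by real_asymp
    show "((\<lambda>s. - exp (- (l * s)) / l) has_real_derivative exp (- (l * s))) (at s)" if "x \<le> s" for s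
      using assms by (auto intro!: derivative_eq_intros)
  qed auto
  then show "(\<integral>\<^sup>+s. ennreal (indicator {x..} s * exp (- (l * s))) \<partial>lborel) = ennreal (exp (- (l * x)) / l)"
    by (simp add: ennreal_mult' mult.commute ennreal_indicator)
qed (use assms in auto)

text \<open>Right minus left vanishes at 0 and has derivative
  \<open>u\<^sup>2 / (2 * (1 + u)\<^sup>2)\<close>. For positive \<open>y\<close> the bound
  \<open>y - y\<^sup>2 / 2\<close> fails; the extra denominator \<open>1 + y\<close> repairs it, at
  the price of only linear decay for large \<open>y\<close>.\<close>

lemma ln_add_one_upper_bound_nonneg:
  fixes y :: real
  assumes "0 \<le> y"
  shows "ln (1 + y) \<le> y - y\<^sup>2 / (2 * (1 + y))"
proof -
  define h where "h = (\<lambda>y::real. y - y\<^sup>2 / (2 * (1 + y)) - ln (1 + y))"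
  have "h 0 \<le> h y"
  proof (rule DERIV_nonneg_imp_nondecreasing[OF assms])
    fix u :: real assume u: "0 \<le> u" "u \<le> y"
    have "(h has_real_derivative (u\<^sup>2 / (2 * (1 + u)\<^sup>2))) (at u)"
    proof (rule DERIV_cong)
      show "(h has_real_derivative (1 - (2 * u * (2 * (1 + u)) - u\<^sup>2 * 2) / (2 * (1 + u))\<^sup>2 - 1 / (1 + u))) (at u)"
        unfolding h_def using u by (auto intro!: derivative_eq_intros simp: power2_eq_square)
      have "1 + u \<noteq> 0" using u by simp
      then show "1 - (2 * u * (2 * (1 + u)) - u\<^sup>2 * 2) / (2 * (1 + u))\<^sup>2 - 1 / (1 + u) = u\<^sup>2 / (2 * (1 + u)\<^sup>2)"
        by (simp add: divide_simps) algebra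
    qed
    then show "\<exists>d. (h has_real_derivative d) (at u) \<and> 0 \<le> d"
      by (intro exI[of _ "u\<^sup>2 / (2 * (1 + u)\<^sup>2)"]) auto
  qed
  then show ?thesis by (simp add: h_def)
qed

text \<open>To the left of 0 the Taylor polynomial itself is an upper bound: right minus left
  vanishes at 0 and has derivative \<open>- u\<^sup>2 / (1 + u)\<close>.\<close>

lemma ln_add_one_upper_bound_nonpos:
  fixes y :: real
  assumes "-1 < y" "y \<le> 0"
  shows "ln (1 + y) \<le> y - y\<^sup>2 / 2"
proof -
  define h where "h = (\<lambda>y::real. y - y\<^sup>2 / 2 - ln (1 + y))"
  have "h 0 \<le> h y"
  proof (rule DERIV_nonpos_imp_nonincreasing[OF assms(2)])
    fix u :: real assume u: "y \<le> u" "u \<le> 0"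
    have "(h has_real_derivative (- u\<^sup>2 / (1 + u))) (at u)"
      unfolding h_def using u assms
      by (auto intro!: derivative_eq_intros simp: divide_simps power2_eq_square) algebra
    then show "\<exists>d. (h has_real_derivative d) (at u) \<and> d \<le> 0"
      using u assms by (intro exI[of _ "- u\<^sup>2 / (1 + u)"]) (auto simp: divide_simps)
  qed
  then show ?thesis by (simp add: h_def)
qed

text \<open>Convergence of \<open>n * p n\<close> forces \<open>p n\<close> to tend to 0, and
  \<open>n * ln (1 - p n)\<close> then differs from \<open>- n * p n\<close> by at most
  \<open>2 * n * (p n)\<^sup>2\<close>, which vanishes in the limit.\<close>

lemma tendsto_one_minus_power:
  fixes p :: "nat \<Rightarrow> real"
  assumes lim: "(\<lambda>n. real n * p n) \<longlonglongrightarrow> l"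
  shows "(\<lambda>n. (1 - p n) ^ n) \<longlonglongrightarrow> exp (- l)"
proof -
  have p0: "p \<longlonglongrightarrow> 0"
  proof (rule Lim_transform_eventually)
    show "(\<lambda>n. (real n * p n) * (1 / real n)) \<longlonglongrightarrow> 0"
      using tendsto_mult[OF lim lim_1_over_n] by simp
    show "\<forall>\<^sub>F n in sequentially. real n * p n * (1 / real n) = p n"
      using eventually_gt_at_top[of 0] by eventually_elim auto
  qed
  have small: "\<forall>\<^sub>F n in sequentially. \<bar>p n\<bar> < 1/2"
    using tendstoD[OF p0, of "1/2"] by (simp add: dist_real_def)
  have "(\<lambda>n. real n * ln (1 - p n) - (- (real n * p n))) \<longlonglongrightarrow> 0"
  proof (rule Lim_null_comparison)
    show "(\<lambda>n. 2 * \<bar>real n * p n\<bar> * \<bar>p n\<bar>) \<longlonglongrightarrow> 0"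
      using tendsto_mult[OF tendsto_mult[OF tendsto_const[of 2] tendsto_rabs[OF lim]] tendsto_rabs[OF p0]]
      by simp
    show "\<forall>\<^sub>F n in sequentially. norm (real n * ln (1 - p n) - (- (real n * p n)))
        \<le> 2 * \<bar>real n * p n\<bar> * \<bar>p n\<bar>"
      using small
    proof eventually_elim
      case (elim n)
      have "\<bar>ln (1 + - p n) - (- p n)\<bar> \<le> 2 * (- p n)\<^sup>2"
        by (rule abs_ln_one_plus_x_minus_x_bound) (use elim in auto)
      then have "real n * \<bar>ln (1 + - p n) - (- p n)\<bar> \<le> real n * (2 * (- p n)\<^sup>2)"
        by (rule mult_left_mono) auto
      also have "\<dots> = 2 * \<bar>real n * p n\<bar> * \<bar>p n\<bar>"
        by (simp add: abs_mult power2_eq_square)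
      also have "real n * \<bar>ln (1 + - p n) - (- p n)\<bar> = norm (real n * ln (1 - p n) - (- (real n * p n)))"
        by (simp flip: abs_mult_pos add: algebra_simps abs_mult)
          (metis abs_mult abs_of_nat distrib_left)
      finally show ?case .
    qed
  qed
  from tendsto_add[OF this tendsto_minus[OF lim]]
  have "(\<lambda>n. exp (real n * ln (1 - p n))) \<longlonglongrightarrow> exp (- l)"
    by (intro tendsto_exp) simp
  then show ?thesis
  proof (rule Lim_transform_eventually)
    show "\<forall>\<^sub>F n in sequentially. exp (real n * ln (1 - p n)) = (1 - p n) ^ n"
      using small by eventually_elim (simp add: exp_of_nat_mult)
  qed
qed

section \<open>Stirling's formula for real arguments by Laplace's method\<close>

lemma has_bochner_integral_exp_neg_half_square:
  "has_bochner_integral lborel (\<lambda>t::real. exp (- t\<^sup>2 / 2)) (sqrt (2 * pi))"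
proof -
  have "has_bochner_integral lborel std_normal_density 1"
    by (simp add: has_bochner_integral_iff)
  then have "has_bochner_integral lborel (\<lambda>t. sqrt (2 * pi) * std_normal_density t) (sqrt (2 * pi) * 1)"
    by (intro has_bochner_integral_mult_right) auto
  then show ?thesis by (simp add: std_normal_density_def)
qed

text \<open>The substitution \<open>u = a + sqrt a * t\<close> in Euler's integral for \<open>Gamma (a + 1)\<close>, divided by
  the value of the integrand at its maximum \<open>u = a\<close>.\<close>

definition stirling_kernel :: "real \<Rightarrow> real \<Rightarrow> real" where
  "stirling_kernel a t = indicator {0..} (a + sqrt a * t) * ((1 + t / sqrt a) powr a * exp (- (sqrt a * t)))"

lemma stirling_kernel_measurable [measurable]: "stirling_kernel a \<in> borel_measurable borel"
  unfolding stirling_kernel_def by measurable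

lemma stirling_kernel_nonneg: "0 \<le> stirling_kernel a t"
  unfolding stirling_kernel_def by simp

text \<open>An integrable majorant that does not depend on \<open>a\<close>. With
  \<open>y = t / sqrt a\<close> the exponent is \<open>a * (ln (1 + y) - y)\<close>; the two
  logarithm bounds give Gaussian decay on the left and exponential decay on the right.\<close>

lemma stirling_kernel_bound:
  assumes "a \<ge> 1"
  shows "stirling_kernel a t \<le> exp (- t\<^sup>2 / 2) + exp (1/2) * (indicator {0..} t * exp (- (1/2 * t)))"
proof -
  define y where "y = t / sqrt a"
  have sa: "sqrt a \<ge> 1" and t: "t = sqrt a * y" and ty: "a + sqrt a * t = a * (1 + y)"
    and sa2: "sqrt a * sqrt a = a"
    using assms by (auto simp: y_def field_simps)
  have eq: "stirling_kernel a t = exp (a * ln (1 + y) - a * y)" if "1 + y > 0"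
    using that assms sa2 mult_pos_pos[of a "1 + y"] unfolding stirling_kernel_def ty y_def[symmetric]
    by (simp add: t powr_def exp_diff exp_minus divide_inverse indicator_def flip: mult.assoc)
  have t2: "t\<^sup>2 = a * y\<^sup>2"
    using assms by (simp add: t power_mult_distrib)
  consider "t \<ge> 0" | "t < 0" "1 + y > 0" | "1 + y \<le> 0" by linarith
  then show ?thesis
  proof cases
    case 1
    then have y: "y \<ge> 0" "y \<le> t" using sa by (auto simp: y_def field_simps mult_le_cancel_left1)
    have "a * ln (1 + y) - a * y \<le> a * (y - y\<^sup>2 / (2 * (1 + y))) - a * y"
      using assms ln_add_one_upper_bound_nonneg[OF y(1)] by (intro diff_right_mono mult_left_mono) auto
    also have "\<dots> = - (t\<^sup>2 / (2 * (1 + y)))" by (simp add: t2 algebra_simps)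
    \<comment> \<open>Since \<open>sqrt a \<ge> 1\<close>, \<open>y \<le> t\<close>; this removes
      the dependence on \<open>a\<close>.\<close>
    also have "\<dots> \<le> - (t\<^sup>2 / (2 * (1 + t)))"
      using y by (intro le_imp_neg_le divide_left_mono mult_pos_pos) auto
    \<comment> \<open>After clearing denominators this is
      \<open>- t\<^sup>2 \<le> (1 - t) * (1 + t)\<close>.\<close>
    also have "\<dots> \<le> 1/2 - 1/2 * t"
      using 1 by (simp add: field_simps power2_eq_square)
    finally have "stirling_kernel a t \<le> exp (1/2) * exp (- (1/2 * t))"
      using eq y by (simp flip: exp_add)
    then show ?thesis using 1 by (simp add: add_increasing)
  next
    case 2
    then have y: "y \<le> 0" using sa by (auto simp: y_def field_simps)
    have "a * ln (1 + y) - a * y \<le> a * (y - y\<^sup>2 / 2) - a * y"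
      using assms ln_add_one_upper_bound_nonpos[OF _ y] 2 by (intro diff_right_mono mult_left_mono) auto
    also have "\<dots> = - t\<^sup>2 / 2" by (simp add: t2 algebra_simps)
    finally show ?thesis using eq 2 by simp
  next
    case 3
    \<comment> \<open>For \<open>1 + y < 0\<close> the indicator vanishes; at
      \<open>1 + y = 0\<close> it is 1, but \<open>0 powr a = 0\<close>.\<close>
    then have "stirling_kernel a t = 0"
      using assms unfolding stirling_kernel_def ty y_def[symmetric]
      by (auto simp: indicator_def zero_le_mult_iff)
    then show ?thesis by simp
  qed
qed

text \<open>Second-order expansion of the logarithm: the linear term of
  \<open>a * ln (1 + t / sqrt a)\<close> is \<open>sqrt a * t\<close>, which cancels, and the
  quadratic term is \<open>- t\<^sup>2 / 2\<close>.\<close>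

lemma stirling_kernel_tendsto:
  "((\<lambda>a. stirling_kernel a t) \<longlongrightarrow> exp (- t\<^sup>2 / 2)) at_top"
proof (rule Lim_transform_eventually)
  have "((\<lambda>a. exp (a * ln (1 + t / sqrt a) - sqrt a * t)) \<longlongrightarrow> exp (- t\<^sup>2 / 2)) at_top"
  proof (cases "t = 0")
    case False
    then have "((\<lambda>a. exp (a * ln (1 + t / sqrt a) - sqrt a * t)) \<longlongrightarrow> exp (- (t * t / 2))) at_top"
      by real_asymp
    then show ?thesis by (simp add: power2_eq_square)
  qed simp
  then show "((\<lambda>a. exp (a * ln (1 + t / sqrt a) - sqrt a * t)) \<longlongrightarrow> exp (- t\<^sup>2 / 2)) at_top" .
  show "\<forall>\<^sub>F a in at_top. exp (a * ln (1 + t / sqrt a) - sqrt a * t) = stirling_kernel a t"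
  proof -
    have "\<forall>\<^sub>F a in at_top. a + sqrt a * t > 0" and "\<forall>\<^sub>F a in at_top. 1 + t / sqrt a > 0"
      by real_asymp+
    then show ?thesis
      by eventually_elim (simp add: stirling_kernel_def powr_def exp_diff exp_minus field_simps)
  qed
qed

text \<open>The factor \<open>sqrt a\<close> is the Jacobian of the substitution, and
  \<open>a powr a * exp (- a)\<close> is the peak value of the integrand.\<close>

lemma Gamma_plus1_eq_stirling_kernel:
  assumes a: "a > 0"
  shows "Gamma (a + 1) = sqrt a * a powr a * exp (- a) * (\<integral>t. stirling_kernel a t \<partial>lborel)"
proof -
  let ?f = "\<lambda>u. indicator {0..} u * u powr a / exp u :: real"
  have "Gamma (a + 1) = (\<integral>u. ?f u \<partial>lborel)"
    using Gamma_conv_nn_integral_real[of "a + 1", symmetric] a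
    by (subst integral_eq_nn_integral) auto
  also have "\<dots> = sqrt a * (\<integral>t. ?f (a + sqrt a * t) \<partial>lborel)"
    using a by (subst lborel_integral_real_affine[where c = "sqrt a" and t = a]) auto
  also have "(\<lambda>t. ?f (a + sqrt a * t)) = (\<lambda>t. a powr a * exp (- a) * stirling_kernel a t)"
  proof
    fix t
    have "a + sqrt a * t = a * (1 + t / sqrt a)"
      using a by (simp add: field_simps)
    moreover have "(a * (1 + t / sqrt a)) powr a = a powr a * (1 + t / sqrt a) powr a"
      by (rule powr_mult)
    ultimately show "?f (a + sqrt a * t) = a powr a * exp (- a) * stirling_kernel a t"
      unfolding stirling_kernel_def
      by (auto simp: indicator_def exp_add exp_minus field_simps)
  qed
  finally show ?thesis by simp
qed

text \<open>Dominated convergence sends the integral of the kernel to the Gaussian integral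
  \<open>sqrt (2 * pi)\<close>. The quotient has \<open>Gamma a\<close> in the denominator because
  it arises in this form as \<open>n\<close> times the density at the centering point.\<close>

lemma Gamma_real_stirling:
  "((\<lambda>a::real. sqrt (2 * pi) * a powr (a - 1/2) * exp (- a) / Gamma a) \<longlongrightarrow> 1) at_top"
proof -
  have "((\<lambda>a. \<integral>t. stirling_kernel a t \<partial>lborel) \<longlongrightarrow> (\<integral>t. exp (- t\<^sup>2 / 2) \<partial>lborel)) at_top"
  proof (rule integral_dominated_convergence_at_top)
    show "integrable lborel (\<lambda>t::real. exp (- t\<^sup>2 / 2) + exp (1/2) * (indicator {0..} t * exp (- (1/2 * t))))"
      using has_bochner_integral_exp_neg_half_square has_bochner_integral_exp_tail[of "1/2" 0]
      by (intro Bochner_Integration.integrable_add integrable_mult_right)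
         (auto simp: has_bochner_integral_iff)
    show "\<forall>\<^sub>F a in at_top. AE t in lborel. norm (stirling_kernel a t)
        \<le> exp (- t\<^sup>2 / 2) + exp (1/2) * (indicator {0..} t * exp (- (1/2 * t)))"
      using eventually_ge_at_top[of 1]
      by eventually_elim (use stirling_kernel_bound stirling_kernel_nonneg in auto)
  qed (use stirling_kernel_tendsto in auto)
  also have "(\<integral>t. exp (- t\<^sup>2 / 2) \<partial>lborel) = sqrt (2 * pi)"
    using has_bochner_integral_exp_neg_half_square by (simp add: has_bochner_integral_iff)
  finally have "((\<lambda>a. sqrt (2 * pi) / (\<integral>t. stirling_kernel a t \<partial>lborel)) \<longlongrightarrow> sqrt (2 * pi) / sqrt (2 * pi)) at_top"
    by (intro tendsto_divide tendsto_const) auto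
  then have "((\<lambda>a. sqrt (2 * pi) / (\<integral>t. stirling_kernel a t \<partial>lborel)) \<longlongrightarrow> 1) at_top"
    by simp
  then show ?thesis
  proof (rule Lim_transform_eventually)
    show "\<forall>\<^sub>F a in at_top. sqrt (2 * pi) / (\<integral>t. stirling_kernel a t \<partial>lborel)
        = sqrt (2 * pi) * a powr (a - 1/2) * exp (- a) / Gamma a"
      using eventually_gt_at_top[of 0]
    proof eventually_elim
      case (elim a)
      then have "Gamma a \<noteq> 0"
        using Gamma_real_pos[of a] by linarith
      \<comment> \<open>The functional equation passes from \<open>a + 1\<close> to
        \<open>a\<close>; cancelling \<open>a = sqrt a * sqrt a\<close> lowers the exponent
        \<open>a\<close> to \<open>a - 1/2\<close>.\<close>
      have "a * Gamma a = sqrt a * a powr a * exp (- a) * (\<integral>t. stirling_kernel a t \<partial>lborel)"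
        using Gamma_plus1_eq_stirling_kernel[OF elim] Gamma_plus1[of a] elim
        by (auto simp: nonpos_Ints_def)
      moreover have "a powr a = sqrt a * a powr (a - 1/2)"
        using elim by (simp add: powr_diff powr_half_sqrt)
      moreover have "sqrt a * sqrt a = a" using elim by simp
      ultimately have "a * Gamma a = a * (a powr (a - 1/2) * exp (- a) * (\<integral>t. stirling_kernel a t \<partial>lborel))"
        by (metis mult.assoc)
      then have "Gamma a = a powr (a - 1/2) * exp (- a) * (\<integral>t. stirling_kernel a t \<partial>lborel)"
        using elim by simp
      then show ?case
        using \<open>Gamma a \<noteq> 0\<close> by (auto simp: divide_simps)
    qed
  qed
qed

section \<open>Distribution of the maximum of i.i.d. variables\<close>

text \<open>The maximum is at most \<open>t\<close> iff every variable is, so independence gives a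
  product of equal factors. Each factor is written through the upper tail to match the limit of
  \<open>(1 - p n) ^ n\<close>.\<close>

lemma (in prob_space) prob_Max_le_iid:
  fixes Y :: "nat \<Rightarrow> 'a \<Rightarrow> real"
  assumes n: "n \<ge> 1"
    and indep: "indep_vars (\<lambda>_. borel) Y {1..n}"
    and dens: "\<And>i. 1 \<le> i \<Longrightarrow> i \<le> n \<Longrightarrow> distributed M lborel (Y i) (\<lambda>u. ennreal (f u))"
    and f [measurable]: "f \<in> borel_measurable borel" and f0: "\<And>u. 0 \<le> f u"
  shows "prob {\<omega> \<in> space M. Max ((\<lambda>i. Y i \<omega>) ` {1..n}) \<le> t}
       = (1 - (\<integral>u. indicator {t<..} u * f u \<partial>lborel)) ^ n"
proof -
  have Y: "random_variable borel (Y i)" if "i \<in> {1..n}" for i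
    using dens[of i] that by (auto simp: distributed_def)
  have "{\<omega> \<in> space M. Max ((\<lambda>i. Y i \<omega>) ` {1..n}) \<le> t} = (\<Inter>i\<in>{1..n}. Y i -` {..t} \<inter> space M)"
    using n by (auto simp: Max_le_iff)
  then have "prob {\<omega> \<in> space M. Max ((\<lambda>i. Y i \<omega>) ` {1..n}) \<le> t}
      = (\<Prod>i\<in>{1..n}. prob (Y i -` {..t} \<inter> space M))"
    using n indep_varsD_finite[OF indep, of "\<lambda>_. {..t}"] by simp
  also have "\<dots> = (\<Prod>i\<in>{1..n}. 1 - (\<integral>u. indicator {t<..} u * f u \<partial>lborel))"
  proof (rule prod.cong)
    fix i assume i: "i \<in> {1..n}"
    have "Y i -` {..t} \<inter> space M = space M - (Y i -` {t<..} \<inter> space M)" by auto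
    then have "prob (Y i -` {..t} \<inter> space M) = 1 - prob (Y i -` {t<..} \<inter> space M)"
      using Y[OF i] by (simp add: prob_compl measurable_sets)
    also have "prob (Y i -` {t<..} \<inter> space M) = (\<integral>u. indicator {t<..} u * f u \<partial>lborel)"
      using distributed_emeasure[OF dens[of i], of "{t<..}"] i f0
      by (subst integral_eq_nn_integral)
         (auto simp: measure_def mult.commute ennreal_mult' ennreal_indicator)
    finally show "prob (Y i -` {..t} \<inter> space M) = 1 - (\<integral>u. indicator {t<..} u * f u \<partial>lborel)" .
  qed simp
  finally show ?thesis by simp
qed

section \<open>The centering equation\<close>

text \<open>The difference \<open>h\<close> of the two sides is strictly increasing on
  \<open>z \<ge> 1\<close> because \<open>1 - 1 / a < 1\<close>, and it tends to infinity. The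
  assumption \<open>pos\<close> says that \<open>h 1 < 0\<close>, so there is exactly one zero, and
  it lies beyond 1.\<close>

lemma centering_eq_unique_solution:
  assumes a: "a \<ge> 1" and pos: "ln (real n) - (ln (sqrt (2 * pi)) + 1 / 2 * ln a) > 0"
  shows "\<exists>!z. z > 1 \<and> centering_eq n a z"
proof -
  define K where "K = (ln (real n) - (ln (sqrt (2 * pi)) + 1 / 2 * ln a)) / a"
  define h where "h = (\<lambda>z::real. z - 1 - (1 - 1 / a) * ln z - K)"
  have K: "K > 0" using a pos by (simp add: K_def)
  have eq: "centering_eq n a z \<longleftrightarrow> h z = 0" for z
    unfolding centering_eq_def h_def K_def diff_divide_distrib by auto
  have deriv: "(h has_real_derivative (1 - (1 - 1 / a) / z)) (at z)" if "z \<ge> 1" for z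
    unfolding h_def using that by (auto intro!: derivative_eq_intros)
  have dpos: "1 - (1 - 1 / a) / z > 0" if "z \<ge> 1" for z
  proof -
    have "(1 - 1 / a) / z < 1 / z" using that a by (intro divide_strict_right_mono) auto
    also have "\<dots> \<le> 1" using that by simp
    finally show ?thesis by simp
  qed
  have mono: "h y < h z" if "1 \<le> y" "y < z" for y z
    using that by (intro DERIV_pos_imp_increasing[of y z h]) (auto intro!: exI dpos deriv)
  have "filterlim h at_top at_top" unfolding h_def
    by real_asymp
  then obtain b where b: "b \<ge> 1" "h b \<ge> 0"
    by (metis (no_types, lifting) eventually_at_top_linorder filterlim_at_top max.cobounded1 max.cobounded2)
  have "h 1 < 0" using K by (simp add: h_def)
  have "\<exists>z\<ge>1. z \<le> b \<and> h z = 0"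
    using b \<open>h 1 < 0\<close> deriv by (intro IVT) (auto intro: DERIV_isCont)
  then obtain z where "z \<ge> 1" "h z = 0" by blast
  moreover from this have "z > 1" using \<open>h 1 < 0\<close> by (cases "z = 1") auto
  ultimately show ?thesis
    unfolding eq
    by (metis less_irrefl linorder_less_linear mono order_less_imp_le)
qed

lemma centering_eq_lower_bound:
  assumes "a \<ge> 1" "z > 1" "centering_eq n a z"
    and "ln (sqrt (2 * pi)) + 1 / 2 * ln a \<le> 1/2 * ln (real n)"
  shows "z \<ge> 1 + ln (real n) / (2 * a)"
proof -
  have "(ln (sqrt (2 * pi)) + 1 / 2 * ln a) / a \<le> (1/2 * ln (real n)) / a"
    using assms by (intro divide_right_mono) auto
  moreover have "(1 - 1 / a) * ln z \<ge> 0" using assms by simp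
  ultimately show ?thesis using assms(3) unfolding centering_eq_def by (simp add: field_simps)
qed

text \<open>The equation, multiplied by \<open>a\<close> and exponentiated, says that
  \<open>n\<close> times the density at \<open>a * z\<close> would be 1 if \<open>Gamma a\<close>
  were replaced by its Stirling approximation. What remains is the ratio of that approximation to
  \<open>Gamma a\<close>.\<close>

lemma gamma_density_at_centering:
  assumes a: "a > 0" and z: "z > 0" and n: "n \<ge> 1" and eq: "centering_eq n a z"
  shows "real n * gamma_density a (a * z) = sqrt (2 * pi) * a powr (a - 1/2) * exp (- a) / Gamma a"
proof -
  have "ln (real n) = a * z - a + (ln (sqrt (2 * pi)) + 1 / 2 * ln a) - (a - 1) * ln z"
  proof -
    have "a * z = a * (1 + ln (real n) / a - (ln (sqrt (2 * pi)) + 1 / 2 * ln a) / a + (1 - 1 / a) * ln z)"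
      using eq unfolding centering_eq_def by (rule arg_cong)
    also have "\<dots> = a + ln (real n) - (ln (sqrt (2 * pi)) + 1 / 2 * ln a) + (a - 1) * ln z"
    proof -
      have "a * (1 + L / a - S / a + (1 - 1 / a) * l) = a + L - S + (a - 1) * l" for L S l
        using a by (simp add: field_simps)
      then show ?thesis .
    qed
    finally show ?thesis by linarith
  qed
  then have "real n = exp (a * z - a + (ln (sqrt (2 * pi)) + 1 / 2 * ln a) - (a - 1) * ln z)"
    using n by (metis exp_ln of_nat_0_less_iff less_le_trans zero_less_one)
  \<comment> \<open>All terms in \<open>z\<close> cancel; \<open>(a - 1) * ln a\<close> and the half
    logarithm in the equation combine to \<open>(a - 1/2) * ln a\<close>.\<close>
  also have "\<dots> * ((a * z) powr (a - 1) * exp (- (a * z)))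
      = exp (ln (sqrt (2 * pi)) + (a - 1/2) * ln a - a)"
    using a z by (simp add: powr_def ln_mult algebra_simps flip: exp_add)
  also have "\<dots> = sqrt (2 * pi) * a powr (a - 1/2) * exp (- a)"
  proof -
    have "exp (ln (sqrt (2 * pi)) + (a - 1/2) * ln a - a) = exp (ln (sqrt (2 * pi))) * exp ((a - 1/2) * ln a) * exp (- a)"
      by (simp only: exp_add[symmetric] add_uminus_conv_diff)
    then show ?thesis using a by (simp add: powr_def)
  qed
  finally show ?thesis using a z by (simp add: gamma_density_def)
qed

section \<open>Asymptotics of the Gamma tail beyond the centering point\<close>

text \<open>Up to the factor \<open>gamma_density a \<zeta>\<close>, this is the Gamma density after the substitution
  \<open>u = \<zeta> + v\<close>. In the variable \<open>s = \<kappa> * v + ln \<kappa>\<close> the kernel tends to \<open>exp (- s)\<close>.\<close>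

definition tail_kernel :: "real \<Rightarrow> real \<Rightarrow> real \<Rightarrow> real" where
  "tail_kernel a \<zeta> s = (let \<kappa> = 1 - a / \<zeta>; v = (s - ln \<kappa>) / \<kappa>
     in exp ((a - 1) * ln (1 + v / \<zeta>) - v) / \<kappa>)"

lemma gamma_density_measurable [measurable]: "gamma_density a \<in> borel_measurable borel"
  unfolding gamma_density_def by measurable

lemma gamma_density_nonneg: "a > 0 \<Longrightarrow> 0 \<le> gamma_density a u"
  using Gamma_real_pos[of a] by (simp add: gamma_density_def)

lemma tail_kernel_measurable [measurable]: "tail_kernel a \<zeta> \<in> borel_measurable borel"
  unfolding tail_kernel_def Let_def by measurable

text \<open>Affine substitution \<open>u = \<zeta> + (s - ln \<kappa>) / \<kappa>\<close>, whose
  Jacobian \<open>1 / \<kappa>\<close> is part of the kernel. The assumption on \<open>x\<close>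
  makes \<open>u\<close> positive for all \<open>s > x\<close>, so that the power in the density
  factors.\<close>

lemma gamma_tail_eq_tail_kernel:
  fixes a \<zeta> x :: real
  assumes a: "0 < a" "a < \<zeta>" and x: "x + \<zeta> * (1 - a / \<zeta>) > 0"
  defines "\<kappa> \<equiv> 1 - a / \<zeta>"
  shows "(\<integral>u. indicator {\<zeta> + (x - ln \<kappa>) / \<kappa><..} u * gamma_density a u \<partial>lborel)
       = gamma_density a \<zeta> * (\<integral>s. indicator {x<..} s * tail_kernel a \<zeta> s \<partial>lborel)"
proof -
  have \<kappa>: "0 < \<kappa>" "\<kappa> < 1" and \<zeta>: "\<zeta> > 0" using a by (auto simp: \<kappa>_def field_simps)
  let ?t = "\<zeta> + (x - ln \<kappa>) / \<kappa>"
  have "(\<integral>u. indicator {?t<..} u * gamma_density a u \<partial>lborel)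
      = 1 / \<kappa> * (\<integral>s. indicator {?t<..} (\<zeta> - ln \<kappa> / \<kappa> + 1 / \<kappa> * s) * gamma_density a (\<zeta> - ln \<kappa> / \<kappa> + 1 / \<kappa> * s) \<partial>lborel)"
    using \<kappa> by (subst lborel_integral_real_affine[where c = "1 / \<kappa>" and t = "\<zeta> - ln \<kappa> / \<kappa>"]) auto
  also have "\<dots> = (\<integral>s. 1 / \<kappa> * (indicator {?t<..} (\<zeta> - ln \<kappa> / \<kappa> + 1 / \<kappa> * s) * gamma_density a (\<zeta> - ln \<kappa> / \<kappa> + 1 / \<kappa> * s)) \<partial>lborel)"
    by simp
  also have "\<dots> = (\<integral>s. gamma_density a \<zeta> * (indicator {x<..} s * tail_kernel a \<zeta> s) \<partial>lborel)"
  proof (rule Bochner_Integration.integral_cong[OF refl])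
    fix s :: real
    define v where "v = (s - ln \<kappa>) / \<kappa>"
    have u: "\<zeta> - ln \<kappa> / \<kappa> + 1 / \<kappa> * s = \<zeta> + v"
      by (simp add: v_def diff_divide_distrib)
    have ind: "indicator {?t<..} (\<zeta> + v) = (indicator {x<..} s :: real)"
      using \<kappa> by (auto simp: indicator_def v_def divide_less_cancel)
    have "1 / \<kappa> * gamma_density a (\<zeta> + v) = gamma_density a \<zeta> * tail_kernel a \<zeta> s" if s: "s > x"
    proof -
      have "0 < s + \<zeta> * \<kappa>" using s x by (simp add: \<kappa>_def)
      \<comment> \<open>Here \<open>ln \<kappa> < 0\<close>, as \<open>\<kappa> < 1\<close>.\<close>
      also have "\<dots> \<le> (s - ln \<kappa>) + \<zeta> * \<kappa>" using \<kappa> by simp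
      finally have pos: "0 < \<zeta> + v" using \<kappa> by (simp add: v_def field_simps)
      then have pos': "0 < 1 + v / \<zeta>" using \<zeta> by (simp add: field_simps)
      have "\<zeta> + v = \<zeta> * (1 + v / \<zeta>)" using \<zeta> by (simp add: field_simps)
      then have "(\<zeta> + v) powr (a - 1) = \<zeta> powr (a - 1) * (1 + v / \<zeta>) powr (a - 1)"
        by (metis powr_mult)
      also have "(1 + v / \<zeta>) powr (a - 1) = exp ((a - 1) * ln (1 + v / \<zeta>))"
        using pos' by (simp add: powr_def)
      finally show ?thesis
        using pos \<zeta> unfolding tail_kernel_def Let_def \<kappa>_def[symmetric] v_def[symmetric]
        by (simp add: gamma_density_def exp_add exp_diff exp_minus divide_inverse)
    qed
    then show "1 / \<kappa> * (indicator {?t<..} (\<zeta> - ln \<kappa> / \<kappa> + 1 / \<kappa> * s) * gamma_density a (\<zeta> - ln \<kappa> / \<kappa> + 1 / \<kappa> * s))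
        = gamma_density a \<zeta> * (indicator {x<..} s * tail_kernel a \<zeta> s)"
      unfolding u ind by (auto simp: indicator_def)
  qed
  finally show ?thesis by simp
qed

text \<open>By \<open>ln (1 + y) \<le> y\<close> the exponent is at most
  \<open>- \<kappa> * v - v / \<zeta>\<close>. The first term is \<open>ln \<kappa> - s\<close>,
  whose \<open>ln \<kappa>\<close> cancels the division by \<kappa>; the second is at most 1 because
  \<open>v > - \<zeta>\<close>, whence the factor \<open>exp 1\<close>.\<close>

lemma tail_kernel_bound:
  fixes a \<zeta> s x d :: real
  assumes a: "1 \<le> a" "a < \<zeta>" and d: "0 < d" "d \<le> 1 - a / \<zeta>" and x: "- d * \<zeta> < x" "x \<le> s"
  shows "tail_kernel a \<zeta> s \<le> exp 1 * exp (- s)"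
proof -
  define \<kappa> where "\<kappa> = 1 - a / \<zeta>"
  define v where "v = (s - ln \<kappa>) / \<kappa>"
  have \<kappa>: "0 < \<kappa>" "\<kappa> < 1" "d \<le> \<kappa>" and \<zeta>: "\<zeta> > 0" using a d by (auto simp: \<kappa>_def field_simps)
  have kv: "\<kappa> * v = s - ln \<kappa>" using \<kappa> by (simp add: v_def)
  have "- \<kappa> * \<zeta> \<le> - d * \<zeta>" using \<kappa> \<zeta> by simp
  also have "\<dots> < s - ln \<kappa>" using x \<kappa> by (smt (verit) ln_less_zero)
  finally have "\<kappa> * (- \<zeta>) < \<kappa> * v" unfolding kv by simp
  then have v: "- \<zeta> < v" by (rule mult_left_less_imp_less) (use \<kappa> in simp)
  have "ln (1 + v / \<zeta>) \<le> v / \<zeta>"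
    using v \<zeta> by (intro ln_add_one_self_le_self2) (simp add: field_simps)
  then have "(a - 1) * ln (1 + v / \<zeta>) - v \<le> (a - 1) * (v / \<zeta>) - v"
    using a by (intro diff_right_mono mult_left_mono) auto
  also have "\<dots> = - (\<kappa> * v) - v / \<zeta>"
    by (simp add: \<kappa>_def algebra_simps diff_divide_distrib)
  also have "\<dots> \<le> - (s - ln \<kappa>) + 1"
  proof -
    have "- 1 \<le> v / \<zeta>" using v \<zeta> by (simp add: field_simps)
    then show ?thesis using kv by linarith
  qed
  finally have "exp ((a - 1) * ln (1 + v / \<zeta>) - v) / \<kappa> \<le> exp (- (s - ln \<kappa>) + 1) / \<kappa>"
    using \<kappa> by (simp add: divide_right_mono)
  also have "\<dots> = exp 1 * exp (- s)"
    using \<kappa> by (simp add: exp_add exp_diff exp_minus field_simps)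
  finally show ?thesis
    unfolding tail_kernel_def Let_def \<kappa>_def[symmetric] v_def[symmetric] .
qed

text \<open>For fixed \<open>s\<close>, \<open>v\<close> stays bounded because \<kappa> is bounded
  below. Linearizing the logarithm therefore costs only O(1 / \<zeta>), and the exponent approaches
  \<open>- \<kappa> * v = ln \<kappa> - s\<close>.\<close>

lemma tail_kernel_tendsto:
  fixes a \<zeta> :: "nat \<Rightarrow> real"
  assumes a: "\<forall>\<^sub>F n in sequentially. 1 \<le> a n \<and> a n < \<zeta> n"
    and \<zeta>: "filterlim \<zeta> at_top sequentially"
    and d: "0 < d" "\<forall>\<^sub>F n in sequentially. d \<le> 1 - a n / \<zeta> n"
  shows "(\<lambda>n. tail_kernel (a n) (\<zeta> n) s) \<longlonglongrightarrow> exp (- s)"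
proof -
  define \<kappa> where "\<kappa> n = 1 - a n / \<zeta> n" for n
  define v where "v n = (s - ln (\<kappa> n)) / \<kappa> n" for n
  \<comment> \<open>Bounds \<open>\<bar>v n\<bar>\<close>: from
    \<open>d \<le> \<kappa> n < 1\<close> one gets
    \<open>0 < - ln (\<kappa> n) \<le> - ln d\<close>, and the division is by at least
    \<open>d\<close>.\<close>
  define B where "B = (\<bar>s\<bar> - ln d) / d"
  have inv: "(\<lambda>n. b / \<zeta> n) \<longlonglongrightarrow> 0" for b
    using \<zeta> by (rule real_tendsto_divide_at_top[OF tendsto_const])
  have ev: "\<forall>\<^sub>F n in sequentially. 1 \<le> a n \<and> a n < \<zeta> n \<and> 0 < \<kappa> n \<and> \<kappa> n < 1 \<and> \<bar>v n\<bar> \<le> B"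
    using a d(2)
  proof eventually_elim
    case (elim n)
    then have k: "0 < \<kappa> n" "\<kappa> n < 1" "d \<le> \<kappa> n" using d(1) by (auto simp: \<kappa>_def field_simps)
    have "\<bar>s - ln (\<kappa> n)\<bar> \<le> \<bar>s\<bar> - ln d"
      using k d(1) ln_mono[of d "\<kappa> n"] ln_less_zero[of "\<kappa> n"] by linarith
    then have "\<bar>s - ln (\<kappa> n)\<bar> / \<kappa> n \<le> B"
      unfolding B_def using k d(1) by (intro frac_le) auto
    then show ?case using elim k by (auto simp: v_def)
  qed
  have "(\<lambda>n. ((a n - 1) * ln (1 + v n / \<zeta> n) - v n) + \<kappa> n * v n) \<longlonglongrightarrow> 0"
  proof (rule Lim_null_comparison)
    \<comment> \<open>The first term bounds the quadratic remainder of the logarithm, using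
      \<open>a n - 1 \<le> \<zeta> n\<close>; the second bounds the \<open>- y\<close> left over
      from the \<open>- 1\<close> in \<open>a n - 1\<close>.\<close>
    show "(\<lambda>n. 2 * B\<^sup>2 / \<zeta> n + B / \<zeta> n) \<longlonglongrightarrow> 0"
      using tendsto_add[OF inv inv] by simp
    have small: "\<forall>\<^sub>F n in sequentially. B / \<zeta> n < 1/2"
      using inv[of B] by (rule order_tendstoD) simp
    show "\<forall>\<^sub>F n in sequentially. norm (((a n - 1) * ln (1 + v n / \<zeta> n) - v n) + \<kappa> n * v n)
        \<le> 2 * B\<^sup>2 / \<zeta> n + B / \<zeta> n"
      using ev small
    proof eventually_elim
      case (elim n)
      then have z: "\<zeta> n > 0" by linarith
      define y where "y = v n / \<zeta> n"
      have y: "\<bar>y\<bar> \<le> B / \<zeta> n" using elim z by (simp add: y_def divide_right_mono)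
      have b: "\<bar>ln (1 + y) - y\<bar> \<le> 2 * y\<^sup>2"
        using y elim by (intro abs_ln_one_plus_x_minus_x_bound) linarith
      have "((a n - 1) * ln (1 + y) - v n) + \<kappa> n * v n = (a n - 1) * (ln (1 + y) - y) - y"
        by (simp add: \<kappa>_def y_def algebra_simps diff_divide_distrib)
      then have "\<bar>((a n - 1) * ln (1 + y) - v n) + \<kappa> n * v n\<bar> \<le> \<bar>(a n - 1) * (ln (1 + y) - y)\<bar> + \<bar>y\<bar>"
        by linarith
      also have "\<bar>(a n - 1) * (ln (1 + y) - y)\<bar> = (a n - 1) * \<bar>ln (1 + y) - y\<bar>"
        using elim by (simp add: abs_mult)
      also have "\<dots> \<le> \<zeta> n * (2 * y\<^sup>2)"
        using b elim z by (intro mult_mono) auto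
      also have "\<zeta> n * (2 * y\<^sup>2) = 2 * (v n)\<^sup>2 / \<zeta> n"
        using z by (simp add: y_def power2_eq_square)
      also have "\<dots> \<le> 2 * B\<^sup>2 / \<zeta> n"
        using z elim by (intro divide_right_mono mult_left_mono) (auto intro: abs_le_square_iff[THEN iffD1])
      finally show ?case using y by (simp add: y_def)
    qed
  qed
  then have "(\<lambda>n. exp (((a n - 1) * ln (1 + v n / \<zeta> n) - v n) + \<kappa> n * v n) * exp (- s)) \<longlonglongrightarrow> exp 0 * exp (- s)"
    by (intro tendsto_intros)
  then have "(\<lambda>n. exp (((a n - 1) * ln (1 + v n / \<zeta> n) - v n) + \<kappa> n * v n) * exp (- s)) \<longlonglongrightarrow> exp (- s)"
    by simp
  then show ?thesis
  proof (rule Lim_transform_eventually)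
    show "\<forall>\<^sub>F n in sequentially. exp (((a n - 1) * ln (1 + v n / \<zeta> n) - v n) + \<kappa> n * v n) * exp (- s)
        = tail_kernel (a n) (\<zeta> n) s"
      using ev
    proof eventually_elim
      case (elim n)
      then have "\<kappa> n * v n = s - ln (\<kappa> n)" by (simp add: v_def)
      then have "exp (\<kappa> n * v n) * exp (- s) = 1 / \<kappa> n"
        using elim by (simp add: exp_diff exp_minus)
      then show ?case
        unfolding tail_kernel_def Let_def \<kappa>_def[symmetric] v_def[symmetric]
        by (simp add: exp_add mult.assoc)
    qed
  qed
qed

text \<open>Dominated convergence with majorant \<open>exp 1 * exp (- s)\<close> on the half-line
  from \<open>x\<close>.\<close>

lemma tail_kernel_integral_tendsto:
  fixes a \<zeta> :: "nat \<Rightarrow> real"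
  assumes a: "\<forall>\<^sub>F n in sequentially. 1 \<le> a n \<and> a n < \<zeta> n"
    and \<zeta>: "filterlim \<zeta> at_top sequentially"
    and d: "0 < d" "\<forall>\<^sub>F n in sequentially. d \<le> 1 - a n / \<zeta> n"
  shows "(\<lambda>n. \<integral>s. indicator {x<..} s * tail_kernel (a n) (\<zeta> n) s \<partial>lborel) \<longlonglongrightarrow> exp (- x)"
proof -
  \<comment> \<open>This is the condition \<open>- d * \<zeta> n < x\<close> of the kernel
    bound.\<close>
  have "\<forall>\<^sub>F n in sequentially. \<zeta> n > - x / d"
    using \<zeta> by (auto simp: filterlim_at_top_dense)
  then have "\<forall>\<^sub>F n in sequentially. \<forall>s. norm (indicator {x<..} s * tail_kernel (a n) (\<zeta> n) s)
      \<le> exp 1 * (indicator {x..} s * exp (- (1 * s)))"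
    using a d(2)
  proof eventually_elim
    case (elim n)
    have x: "- d * \<zeta> n < x" using elim d(1) by (simp add: field_simps)
    have k: "1 - a n / \<zeta> n > 0" using elim d(1) by linarith
    have "tail_kernel (a n) (\<zeta> n) s \<ge> 0" for s
      using k by (simp add: tail_kernel_def Let_def)
    moreover have "tail_kernel (a n) (\<zeta> n) s \<le> exp 1 * exp (- s)" if "x < s" for s
      using elim d(1) x that by (intro tail_kernel_bound[of _ _ d x]) auto
    ultimately show ?case by (auto simp: indicator_def)
  qed
  then obtain N where N: "\<And>n s. n \<ge> N \<Longrightarrow> norm (indicator {x<..} s * tail_kernel (a n) (\<zeta> n) s)
      \<le> exp 1 * (indicator {x..} s * exp (- (1 * s)))"
    unfolding eventually_sequentially by blast
  have tail: "has_bochner_integral lborel (\<lambda>s. indicator {x..} s * exp (- (1 * s))) (exp (- x))"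
    using has_bochner_integral_exp_tail[of 1 x] by simp
  \<comment> \<open>The majorant is available only from index \<open>N\<close> on, so the sequence
    is shifted by \<open>N\<close>.\<close>
  have "(\<lambda>n. \<integral>s. indicator {x<..} s * tail_kernel (a (n + N)) (\<zeta> (n + N)) s \<partial>lborel)
      \<longlonglongrightarrow> (\<integral>s. indicator {x<..} s * exp (- s) \<partial>lborel)"
  proof (rule integral_dominated_convergence)
    show "integrable lborel (\<lambda>s. exp 1 * (indicator {x..} s * exp (- (1 * s))))"
      using tail by (intro integrable_mult_right) (auto simp: has_bochner_integral_iff)
    show "AE s in lborel. (\<lambda>n. indicator {x<..} s * tail_kernel (a (n + N)) (\<zeta> (n + N)) s)
        \<longlonglongrightarrow> indicator {x<..} s * exp (- s)"
      using LIMSEQ_ignore_initial_segment[OF tail_kernel_tendsto[OF assms]]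
      by (auto intro!: tendsto_mult)
  qed (use N in auto)
  then have "(\<lambda>n. \<integral>s. indicator {x<..} s * tail_kernel (a n) (\<zeta> n) s \<partial>lborel)
      \<longlonglongrightarrow> (\<integral>s. indicator {x<..} s * exp (- s) \<partial>lborel)"
    by (rule LIMSEQ_offset)
  also have "(\<integral>s. indicator {x<..} s * exp (- s) \<partial>lborel) = (\<integral>s. indicator {x..} s * exp (- (1 * s)) \<partial>lborel)"
    by (rule integral_cong_AE) (use AE_lborel_singleton[of x] in \<open>auto simp: indicator_def\<close>)
  also have "\<dots> = exp (- x)"
    using tail by (simp add: has_bochner_integral_iff)
  finally show ?thesis .
qed

section \<open>Gumbel limit of the normalized maximum\<close>

theorem theorem2p2:
  fixes \<alpha> :: "nat \<Rightarrow> real"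
    and P :: "nat \<Rightarrow> 'a measure"
    and Y :: "nat \<Rightarrow> nat \<Rightarrow> 'a \<Rightarrow> real"
  assumes alpha_pos: "\<And>n. n \<ge> 1 \<Longrightarrow> \<alpha> n > 0"
    and prob: "\<And>n. n \<ge> 1 \<Longrightarrow> prob_space (P n)"
    and indep: "\<And>n. n \<ge> 1 \<Longrightarrow> prob_space.indep_vars (P n) (\<lambda>_. borel) (Y n) {1..n}"
    and gamma: "\<And>n i. 1 \<le> i \<Longrightarrow> i \<le> n \<Longrightarrow>
      distributed (P n) lborel (Y n i) (\<lambda>u. ennreal (gamma_density (\<alpha> n) u))"
    and bounded: "\<exists>c C. 0 < c \<and> (\<forall>n\<ge>2. c \<le> \<alpha> n / ln (real n) \<and> \<alpha> n / ln (real n) \<le> C)"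
  shows "(\<forall>\<^sub>F n in sequentially. \<exists>!z. z > 1 \<and> centering_eq n (\<alpha> n) z) \<and>
    (\<forall>\<zeta> :: nat \<Rightarrow> real.
      (\<forall>\<^sub>F n in sequentially. \<zeta> n / \<alpha> n > 1 \<and> centering_eq n (\<alpha> n) (\<zeta> n / \<alpha> n)) \<longrightarrow>
      weak_conv_m
        (\<lambda>n. distr (P n) borel (\<lambda>\<omega>.
           (1 - \<alpha> n / \<zeta> n) * (Max ((\<lambda>i. Y n i \<omega>) ` {1..n}) - \<zeta> n)
             + ln (1 - \<alpha> n / \<zeta> n)))
        gumbel)"
proof -
  obtain c C where c: "0 < c"
    and bd: "\<And>n. n \<ge> 2 \<Longrightarrow> c \<le> \<alpha> n / ln (real n) \<and> \<alpha> n / ln (real n) \<le> C"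
    using bounded by blast
  have bd': "c * ln (real n) \<le> \<alpha> n" "\<alpha> n \<le> C * ln (real n)" "ln (real n) > 0" if "n \<ge> 2" for n
    using bd[OF that] that by (auto simp: field_simps)
  have C: "C > 0" using bd[of 2] c by linarith
  have \<alpha>_top: "filterlim \<alpha> at_top sequentially"
  proof (rule filterlim_at_top_mono)
    show "filterlim (\<lambda>n. c * ln (real n)) at_top sequentially" using c by real_asymp
    show "\<forall>\<^sub>F n in sequentially. c * ln (real n) \<le> \<alpha> n"
      using eventually_ge_at_top[of 2] by eventually_elim (rule bd')
  qed
  then have \<alpha>_ge1: "\<forall>\<^sub>F n in sequentially. 1 \<le> \<alpha> n"
    by (auto simp: filterlim_at_top)
  \<comment> \<open>As \<alpha> is at most \<open>C * ln n\<close>, the Stirling correction is of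
    order \<open>ln (ln n)\<close>. Being at most half of \<open>ln n\<close>, it yields both
    existence of the root and its distance from 1.\<close>
  have "\<forall>\<^sub>F n in sequentially. ln (sqrt (2 * pi)) + 1 / 2 * ln (C * ln (real n)) \<le> 1 / 2 * ln (real n)"
    using C by real_asymp
  then have correction: "\<forall>\<^sub>F n in sequentially.
      ln (sqrt (2 * pi)) + 1 / 2 * ln (\<alpha> n) \<le> 1 / 2 * ln (real n)"
    using \<alpha>_ge1 eventually_ge_at_top[of 2]
  proof eventually_elim
    case (elim n)
    have "ln (\<alpha> n) \<le> ln (C * ln (real n))"
      using bd'[OF elim(3)] elim by (intro ln_mono) auto
    then show ?case using elim by linarith
  qed
  show ?thesis
  proof (intro conjI allI impI)
    show "\<forall>\<^sub>F n in sequentially. \<exists>!z. z > 1 \<and> centering_eq n (\<alpha> n) z"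
      using \<alpha>_ge1 correction eventually_ge_at_top[of 2]
    proof eventually_elim
      case (elim n)
      show ?case
        by (rule centering_eq_unique_solution) (use elim bd'(3)[of n] in linarith)+
    qed
  next
    fix \<zeta> :: "nat \<Rightarrow> real"
    assume \<zeta>: "\<forall>\<^sub>F n in sequentially. \<zeta> n / \<alpha> n > 1 \<and> centering_eq n (\<alpha> n) (\<zeta> n / \<alpha> n)"
    define \<kappa> where "\<kappa> n = 1 - \<alpha> n / \<zeta> n" for n
    \<comment> \<open>The lower bound for the root together with
      \<open>ln n / \<alpha> n \<ge> 1 / C\<close> gives
      \<open>\<zeta> n / \<alpha> n \<ge> 1 + 1 / (2 * C)\<close>, which is
      \<open>\<kappa> n \<ge> d\<close>.\<close>
    define d where "d = 1 - 1 / (1 + 1 / (2 * C))"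
    have d: "d > 0" using C by (simp add: d_def field_simps)
    have ge: "\<forall>\<^sub>F n in sequentially. 1 \<le> \<alpha> n \<and> \<alpha> n < \<zeta> n"
      using \<zeta> \<alpha>_ge1 by eventually_elim (auto simp: field_simps)
    have \<zeta>_top: "filterlim \<zeta> at_top sequentially"
      by (rule filterlim_at_top_mono[OF \<alpha>_top]) (use ge in eventually_elim, auto)
    have \<kappa>_ge: "\<forall>\<^sub>F n in sequentially. d \<le> 1 - \<alpha> n / \<zeta> n"
      using \<zeta> ge correction eventually_ge_at_top[of 2]
    proof eventually_elim
      case (elim n)
      have "1 / (2 * C) \<le> ln (real n) / (2 * \<alpha> n)"
        using bd'[OF elim(4)] C elim by (simp add: field_simps)
      moreover have "1 + ln (real n) / (2 * \<alpha> n) \<le> \<zeta> n / \<alpha> n"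
        using elim by (intro centering_eq_lower_bound) auto
      ultimately have "1 + 1 / (2 * C) \<le> \<zeta> n / \<alpha> n" by linarith
      then have "1 / (\<zeta> n / \<alpha> n) \<le> 1 / (1 + 1 / (2 * C))"
        using C by (intro frac_le) (auto intro: add_pos_pos)
      then show ?case by (simp add: d_def)
    qed
    have "(\<lambda>n. sqrt (2 * pi) * \<alpha> n powr (\<alpha> n - 1/2) * exp (- \<alpha> n) / Gamma (\<alpha> n)) \<longlonglongrightarrow> 1"
      by (rule filterlim_compose[OF Gamma_real_stirling \<alpha>_top])
    then have dens: "(\<lambda>n. real n * gamma_density (\<alpha> n) (\<zeta> n)) \<longlonglongrightarrow> 1"
    proof (rule Lim_transform_eventually)
      show "\<forall>\<^sub>F n in sequentially. sqrt (2 * pi) * \<alpha> n powr (\<alpha> n - 1/2) * exp (- \<alpha> n) / Gamma (\<alpha> n)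
          = real n * gamma_density (\<alpha> n) (\<zeta> n)"
        using \<zeta> ge eventually_ge_at_top[of 1]
      proof eventually_elim
        case (elim n)
        then show ?case
          using gamma_density_at_centering[of "\<alpha> n" "\<zeta> n / \<alpha> n" n] by simp
      qed
    qed
    show "weak_conv_m
        (\<lambda>n. distr (P n) borel (\<lambda>\<omega>.
           (1 - \<alpha> n / \<zeta> n) * (Max ((\<lambda>i. Y n i \<omega>) ` {1..n}) - \<zeta> n)
             + ln (1 - \<alpha> n / \<zeta> n))) gumbel"
      unfolding weak_conv_m_def weak_conv_def \<kappa>_def[symmetric]
    proof (intro allI impI)
      fix x :: real
      \<comment> \<open>The probability that a single observation exceeds the threshold;
        \<open>n * p n\<close> is the expected number of exceedances.\<close>
      define p where "p n = (\<integral>u. indicator {\<zeta> n + (x - ln (\<kappa> n)) / \<kappa> n<..} u * gamma_density (\<alpha> n) u \<partial>lborel)" for n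
      \<comment> \<open>Ensures \<open>x + \<zeta> n * \<kappa> n > 0\<close>, as the substitution
        in the tail integral requires.\<close>
      have "\<forall>\<^sub>F n in sequentially. \<zeta> n > - x / d"
        using \<zeta>_top by (auto simp: filterlim_at_top_dense)
      then have "\<forall>\<^sub>F n in sequentially. real n * gamma_density (\<alpha> n) (\<zeta> n)
            * (\<integral>s. indicator {x<..} s * tail_kernel (\<alpha> n) (\<zeta> n) s \<partial>lborel) = real n * p n"
        using ge \<kappa>_ge
      proof eventually_elim
        case (elim n)
        have "0 < x + \<zeta> n * d" using elim d by (simp add: field_simps)
        also have "\<dots> \<le> x + \<zeta> n * (1 - \<alpha> n / \<zeta> n)" using elim by (intro add_left_mono mult_left_mono) auto
        finally show ?case
          using gamma_tail_eq_tail_kernel[of "\<alpha> n" "\<zeta> n" x] elim by (simp add: p_def \<kappa>_def)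
      qed
      moreover have "(\<lambda>n. real n * gamma_density (\<alpha> n) (\<zeta> n)
            * (\<integral>s. indicator {x<..} s * tail_kernel (\<alpha> n) (\<zeta> n) s \<partial>lborel)) \<longlonglongrightarrow> exp (- x)"
        using tendsto_mult[OF dens tail_kernel_integral_tendsto[OF ge \<zeta>_top d \<kappa>_ge, of x]] by simp
      ultimately have "(\<lambda>n. real n * p n) \<longlonglongrightarrow> exp (- x)"
        by (rule Lim_transform_eventually[rotated])
      then have "(\<lambda>n. (1 - p n) ^ n) \<longlonglongrightarrow> exp (- exp (- x))"
        by (rule tendsto_one_minus_power)
      then show "(\<lambda>n. cdf (distr (P n) borel (\<lambda>\<omega>.
            \<kappa> n * (Max ((\<lambda>i. Y n i \<omega>) ` {1..n}) - \<zeta> n) + ln (\<kappa> n))) x) \<longlonglongrightarrow> cdf gumbel x"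
        unfolding cdf_gumbel gumbel_cdf_def
      proof (rule Lim_transform_eventually)
        show "\<forall>\<^sub>F n in sequentially. (1 - p n) ^ n = cdf (distr (P n) borel (\<lambda>\<omega>.
            \<kappa> n * (Max ((\<lambda>i. Y n i \<omega>) ` {1..n}) - \<zeta> n) + ln (\<kappa> n))) x"
          using \<kappa>_ge eventually_ge_at_top[of 1]
        proof eventually_elim
          case (elim n)
          then have \<kappa>: "\<kappa> n > 0" using d by (simp add: \<kappa>_def)
          interpret prob_space "P n" by (rule prob[OF elim(2)])
          have [measurable]: "(\<lambda>\<omega>. Max ((\<lambda>i. Y n i \<omega>) ` {1..n})) \<in> borel_measurable (P n)"
            using gamma[of _ n] by (intro borel_measurable_Max) (auto simp: distributed_def)
          have meas: "(\<lambda>\<omega>. \<kappa> n * (Max ((\<lambda>i. Y n i \<omega>) ` {1..n}) - \<zeta> n) + ln (\<kappa> n)) \<in> borel_measurable (P n)"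
            by measurable
          have "cdf (distr (P n) borel (\<lambda>\<omega>. \<kappa> n * (Max ((\<lambda>i. Y n i \<omega>) ` {1..n}) - \<zeta> n) + ln (\<kappa> n))) x
              = prob {\<omega> \<in> space (P n). \<kappa> n * (Max ((\<lambda>i. Y n i \<omega>) ` {1..n}) - \<zeta> n) + ln (\<kappa> n) \<le> x}"
            unfolding cdf_def by (subst measure_distr[OF meas]) (auto intro!: arg_cong[where f = prob])
          also have "{\<omega> \<in> space (P n). \<kappa> n * (Max ((\<lambda>i. Y n i \<omega>) ` {1..n}) - \<zeta> n) + ln (\<kappa> n) \<le> x}
              = {\<omega> \<in> space (P n). Max ((\<lambda>i. Y n i \<omega>) ` {1..n}) \<le> \<zeta> n + (x - ln (\<kappa> n)) / \<kappa> n}"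
          proof -
            have "\<kappa> n * (m - \<zeta> n) + ln (\<kappa> n) \<le> x \<longleftrightarrow> m \<le> \<zeta> n + (x - ln (\<kappa> n)) / \<kappa> n" for m
              using \<kappa> by (simp add: field_simps)
            then show ?thesis by simp
          qed
          also have "prob \<dots> = (1 - p n) ^ n"
            unfolding p_def
            by (rule prob_Max_le_iid[OF elim(2) indep[OF elim(2)] gamma])
               (use gamma_density_nonneg alpha_pos elim in auto)
          finally show ?case by simp
        qed
      qed
    qed
  qed
qed

end
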